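(* Assume: (i) there is $\epsilon>0$ such that $Q(y\mid x)\ge\epsilon$ for every $x\in\mathbb{X}$ and $y\in\mathbb{Y}$; (ii) for every $u\in\mathbb{U}$ the transition kernel $\mathcal{T}(\cdot\mid\cdot,u)$ is a mixing kernel, with mixing constant $\epsilon_u\in(0,1]$. Let $z^*\in\mathcal{P}(\mathbb{X})$ and, for $N\ge1$, $$\bar L_{TV}^N:=\sup_{z\in\mathcal{P}(\mathbb{X})}\ \sup_{y_{[0,N]},\,u_{[0,N-1]}}\big\|P^z(X_N\in\cdot\mid y_{[0,N]},u_{[0,N-1]})-P^{z^*}(X_N\in\cdot\mid y_{[0,N]},u_{[0,N-1]})\big\|_{TV}.$$ Then there exist constants $r<1$ and $K$ such that, for all $N\ge1$, $$\bar L_{TV}^N\le r^{N-1}K.$$ Here $K=\frac{2}{\log3}\sup h(Z_1,Z_1^* )$, where $Z_1=P^z(X_1\in\cdot\mid y_{[0,1]},u_0)$, $Z_1^*=P^{z^*}(X_1\in\cdot\mid y_{[0,1]},u_0)$ and the supremum is over $z\in\mathcal{P}(\mathbb{X})$, $y_{[0,1]}\in\mathbb{Y}^2$, $u_0\in\mathbb{U}$; and $r=\sup_{u\in\mathbb{U}}\frac{1-\epsilon_u^2\epsilon}{1+\epsilon_u^2\epsilon}$.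
   Context: $\mathbb{X}$ is a standard Borel space (hidden states) with Borel $\sigma$-algebra $\mathcal{B}(\mathbb{X})$; $\mathbb{Y}$ (observations) and $\mathbb{U}$ (actions) are finite sets; $\mathcal{P}(\mathbb{X})$ is the set of Borel probability measures on $\mathbb{X}$. $\mathcal{T}$ is a stochastic kernel from $\mathbb{X}\times\mathbb{U}$ to $\mathbb{X}$ and $Q$ a stochastic kernel from $\mathbb{X}$ to $\mathbb{Y}$. The state evolves by $X_{t+1}\sim\mathcal{T}(\cdot\mid X_t,u_t)$ and is observed through $Y_t\sim Q(\cdot\mid X_t)$. For a prior $z$ of $X_0$, $P^z(X_k\in\cdot\mid y_{[0,k]},u_{[0,k-1]})=:\pi_k$ is the Bayes posterior: $\pi_0(dx)\propto Q(y_0\mid x)z(dx)$ and $\pi_{k+1}(dx)\propto Q(y_{k+1}\mid x)\int\mathcal{T}(dx\mid x',u_k)\pi_k(dx')$. Here $y_{[0,k]}=(y_0,\dots,y_k)$, and similarly for $u$. $\|\mu-\nu\|_{TV}=2\sup_{B\in\mathcal{B}(\mathbb{X})}|\mu(B)-\nu(B)|$. A nonnegative kernel $K$ on $\mathbb{X}$ is *mixing* with constant $\varepsilon\in(0,1]$ if there is a nonnegative measure $\lambda$ on $\mathbb{X}$ with $\varepsilon\lambda(A)\le K(x,A)\le\frac1\varepsilon\lambda(A)$ for all $x\in\mathbb{X}$ and all Borel $A$. Nonnegative measures $\mu,\nu$ on $\mathbb{X}$ are *comparable* if there are constants $0<a\le b$ with $a\nu(A)\le\mu(A)\le b\nu(A)$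 for all Borel $A$. The Hilbert metric of nonnegative finite measures is $$h(\mu,\nu)=\log\left(\frac{\sup_{A:\nu(A)>0}\mu(A)/\nu(A)}{\inf_{A:\nu(A)>0}\mu(A)/\nu(A)}\right)$$ if $\mu,\nu$ are comparable, $h(\mu,\nu)=0$ if $\mu=\nu=0$, and $h(\mu,\nu)=\infty$ otherwise. *)

theory Defs
  imports "HOL-Probability.Probability"
begin

text \<open>
  A standard Borel space is given by a carrier-based measure space \<open>M\<close> of which only
  \<open>space M\<close> and \<open>sets M\<close> matter.
\<close>

definition standard_borel :: "'a measure \<Rightarrow> bool" where
  "standard_borel M \<longleftrightarrow>
     (\<exists>X. topspace X = space M \<and> completely_metrizable_space X \<and> separable_space X \<and>
          sets M = sigma_sets (space M) {U. openin X U})"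

definition tv_dist :: "'a measure \<Rightarrow> 'a measure \<Rightarrow> ereal" where
  "tv_dist \<mu> \<nu> = 2 * (SUP B\<in>sets \<mu>. ereal \<bar>measure \<mu> B - measure \<nu> B\<bar>)"

definition mixing_kernel :: "'a measure \<Rightarrow> real \<Rightarrow> ('a \<Rightarrow> 'a measure) \<Rightarrow> bool" where
  "mixing_kernel M \<epsilon> K \<longleftrightarrow> 0 < \<epsilon> \<and> \<epsilon> \<le> 1 \<and>
     (\<exists>\<Lambda>. sets \<Lambda> = sets M \<and>
        (\<forall>x\<in>space M. \<forall>A\<in>sets M.
           ennreal \<epsilon> * emeasure \<Lambda> A \<le> emeasure (K x) A \<and>
           emeasure (K x) A \<le> ennreal (1 / \<epsilon>) * emeasure \<Lambda> A))"

definition comparable :: "'a measure \<Rightarrow> 'a measure \<Rightarrow> bool" where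
  "comparable \<mu> \<nu> \<longleftrightarrow> sets \<mu> = sets \<nu> \<and>
     (\<exists>a b :: real. 0 < a \<and> a \<le> b \<and>
        (\<forall>A\<in>sets \<nu>. ennreal a * emeasure \<nu> A \<le> emeasure \<mu> A \<and>
                     emeasure \<mu> A \<le> ennreal b * emeasure \<nu> A))"

text \<open>
  Meaningful for finite measures only. Two zero measures are comparable, but the ratios below
  would then range over the empty set, so that case comes first. In the comparable case the set
  of ratios is nonempty and contained in some \<open>{a..b}\<close> with \<open>0 < a\<close>, so the real-valued
  supremum, infimum and logarithm are the genuine ones.
\<close>

definition hilbert_metric :: "'a measure \<Rightarrow> 'a measure \<Rightarrow> ereal" where
  "hilbert_metric \<mu> \<nu> =
     (if emeasure \<mu> (space \<mu>) = 0 \<and> emeasure \<nu> (space \<nu>) = 0 then 0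
      else if comparable \<mu> \<nu> then
        ereal (ln ((SUP A\<in>{A\<in>sets \<nu>. measure \<nu> A > 0}. measure \<mu> A / measure \<nu> A) /
                   (INF A\<in>{A\<in>sets \<nu>. measure \<nu> A > 0}. measure \<mu> A / measure \<nu> A)))
      else \<infinity>)"

text \<open>
  Conditioning the law \<open>\<mu>\<close> of the hidden state on observing \<open>y\<close>; the denominator is the
  normalising constant.
\<close>

definition bayes_update :: "('a \<Rightarrow> 'y measure) \<Rightarrow> 'y \<Rightarrow> 'a measure \<Rightarrow> 'a measure" where
  "bayes_update Q y \<mu> =
     density \<mu> (\<lambda>x. emeasure (Q x) {y} / (\<integral>\<^sup>+x'. emeasure (Q x') {y} \<partial>\<mu>))"

text \<open>
  \<open>posterior T Q z y u k\<close> is the law of the state at time \<open>k\<close> under the prior \<open>z\<close>, given the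
  observations \<open>y 0, \<dots>, y k\<close> and the actions \<open>u 0, \<dots>, u (k - 1)\<close>. Finite histories are encoded
  as functions on \<open>nat\<close>; the other values of \<open>y\<close> and \<open>u\<close> are not used.
\<close>

primrec posterior ::
  "('a \<times> 'u \<Rightarrow> 'a measure) \<Rightarrow> ('a \<Rightarrow> 'y measure) \<Rightarrow> 'a measure \<Rightarrow>
   (nat \<Rightarrow> 'y) \<Rightarrow> (nat \<Rightarrow> 'u) \<Rightarrow> nat \<Rightarrow> 'a measure" where
  "posterior T Q z y u 0 = bayes_update Q (y 0) z"
| "posterior T Q z y u (Suc k) =
     bayes_update Q (y (Suc k)) (posterior T Q z y u k \<bind> (\<lambda>x. T (x, u k)))"

definition L_TV ::
  "'a measure \<Rightarrow> ('a \<times> 'u \<Rightarrow> 'a measure) \<Rightarrow> ('a \<Rightarrow> 'y measure) \<Rightarrow> 'a measure \<Rightarrow> nat \<Rightarrow> ereal" where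
  "L_TV M T Q zs N =
     (SUP z\<in>space (prob_algebra M). SUP y. SUP u.
        tv_dist (posterior T Q z y u N) (posterior T Q zs y u N))"

end

theory Submission
  imports Defs
begin

text \<open>
  Fix an action \<open>u\<close> and an observation \<open>y\<close>. One step of the filter sends a law \<open>\<mu>\<close> to the
  normalisation of the measure \<open>A \<mapsto> \<integral> \<phi>\<^sub>A d\<mu>\<close>, where \<open>\<phi>\<^sub>A(x) = \<integral>\<^sub>A Q(y|z) T(dz|x,u)\<close>. Since
  \<open>\<epsilon> \<le> Q \<le> 1\<close> and the transition kernel is mixing, \<open>\<phi>\<^sub>A\<close> takes its values in an interval
  \<open>[k L\<^sub>A, L\<^sub>A]\<close> with \<open>k = \<epsilon>\<^sub>u\<^sup>2 \<epsilon>\<close> (\<open>filter_step_representation\<close>). So the step is a positive operator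
  whose kernel is uniformly mixing, and two consequences follow.

  First, such an operator contracts the Hilbert metric by the factor \<open>(1 - k) / (1 + k)\<close>; this is
  Birkhoff's theorem (\<open>birkhoff_contraction\<close>). The nonlinear normalisation does no harm, because the
  Hilbert metric sees only the oscillation of the ratio of two measures and is unchanged by
  constant factors. Secondly, after one step any two laws are comparable, at a Hilbert distance of
  at most \<open>ln (1 / k\<^sup>2)\<close>, whatever the priors were (\<open>filter_step_bounded\<close>). Priors themselves need not be
  comparable, which is why the estimate starts from the posteriors at time 1, and uniformity over
  the finitely many actions makes the supremum that defines \<open>K\<close> finite.

  Contracting \<open>N - 1\<close> times bounds the Hilbert distance of the posteriors at time \<open>N\<close> by \<open>r\<close> to
  the power \<open>N - 1\<close> times that supremum. Total variation is bounded by the Hilbert metric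
  (\<open>tv_dist_le_hilbert_metric\<close>), and the factor \<open>2 / ln 3\<close> is at least 1.

  The Hilbert metric is accessed through cross ratios: \<open>h(\<mu>,\<nu>) \<le> ln C\<close> follows from
  \<open>\<mu>(A) \<nu>(B) \<le> C \<nu>(A) \<mu>(B)\<close> for all \<open>A\<close> and \<open>B\<close> (\<open>hilbert_metric_le_ln\<close>). This form is symmetric and free
  of division, so null sets need no separate treatment.
\<close>

section \<open>Two elementary inequalities\<close>

text \<open>
  This turns the extremal cross ratio of \<open>cross_ratio_le\<close> into a linear bound on its logarithm. Both
  sides vanish at \<open>S = 1\<close>, and the derivative of their difference is a nonnegative multiple of
  \<open>(S - 1)\<^sup>2\<close>.
\<close>

lemma ln_moebius_le:
  fixes S k :: real
  assumes "1 \<le> S" "0 < k" "k \<le> 1"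
  shows "ln ((S + k) / (1 + k * S)) \<le> (1 - k) / (1 + k) * ln S"
proof -
  define f where "f = (\<lambda>x::real. (1 - k) / (1 + k) * ln x - ln (x + k) + ln (1 + k * x))"
  have "f 1 \<le> f S"
  proof (rule DERIV_nonneg_imp_nondecreasing[OF assms(1)])
    fix x :: real assume x: "1 \<le> x" "x \<le> S"
    have pos: "0 < x + k" "0 < 1 + k * x" using x assms by (auto intro: add_pos_pos)
    let ?d = "(1 - k) / (1 + k) * (1 / x) - 1 / (x + k) + k / (1 + k * x)"
    have D: "(f has_real_derivative ?d) (at x)"
      unfolding f_def using x pos assms by (auto intro!: derivative_eq_intros)
    have "?d = (1 - k) * k * (x - 1)\<^sup>2 / ((1 + k) * x * (x + k) * (1 + k * x))"
      using x pos assms by (simp add: divide_simps) (simp add: algebra_simps power2_eq_square)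
    also have "\<dots> \<ge> 0" using x pos assms by auto
    finally show "\<exists>y. (f has_real_derivative y) (at x) \<and> 0 \<le> y" using D by blast
  qed
  moreover have "0 < S + k" "0 < 1 + k * S" using assms by (auto intro: add_pos_pos)
  ultimately show ?thesis by (simp add: f_def ln_div add.commute)
qed

text \<open>
  The analytic core of Birkhoff's theorem. The map \<open>q \<mapsto> (S\<^sup>2 q + 1) / (q + 1)\<close> compares its values at
  \<open>q = s / t\<close> and \<open>q = s' / t'\<close>, two points whose ratio is at most \<open>1 / k\<^sup>2\<close>. The quotient of the values
  is largest when the points are \<open>k / S\<close> and \<open>1 / (k S)\<close>, where it
  equals \<open>((S + k) / (1 + k S))\<^sup>2\<close>. The denominators are cleared, so that \<open>t\<close> and \<open>t'\<close> may vanish.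
\<close>

lemma cross_ratio_le:
  fixes S k s t s' t' :: real
  assumes S: "1 \<le> S" and k: "0 < k" "k \<le> 1"
    and nn: "0 \<le> s" "0 \<le> t" "0 \<le> s'" "0 \<le> t'"
    and cross: "k\<^sup>2 * (s * t') \<le> s' * t"
  shows "(S\<^sup>2 * s + t) * (s' + t') * (1 + k * S)\<^sup>2 \<le> (S + k)\<^sup>2 * ((s + t) * (S\<^sup>2 * s' + t'))"
proof -
  \<comment> \<open>The difference of the two sides has the factor \<open>S\<^sup>2 - 1\<close>. What remains is to bound
    \<open>2 k S (s t' - s' t)\<close> by \<open>(1 - k\<^sup>2) (S\<^sup>2 s s' + t t')\<close>, and the geometric mean \<open>x y\<close> of \<open>s s'\<close> and
    \<open>t t'\<close> separates the two.\<close>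
  define x where "x = sqrt (s * t')"
  define y where "y = sqrt (s' * t)"
  have x: "x\<^sup>2 = s * t'" "0 \<le> x" and y: "y\<^sup>2 = s' * t" "0 \<le> y"
    using nn by (auto simp: x_def y_def)
  have ky: "k * x \<le> y"
  proof (rule power2_le_imp_le)
    show "(k * x)\<^sup>2 \<le> y\<^sup>2" using cross x y by (simp add: power_mult_distrib)
  qed (use y in simp)
  have am_gm: "2 * S * (x * y) \<le> S\<^sup>2 * (s * s') + t * t'"
  proof (rule power2_le_imp_le)
    have "(2 * S * (x * y))\<^sup>2 = 4 * S\<^sup>2 * (x\<^sup>2 * y\<^sup>2)" by (simp add: power_mult_distrib)
    also have "\<dots> = 4 * (S\<^sup>2 * (s * s')) * (t * t')" using x y by (simp add: algebra_simps)
    also have "\<dots> \<le> (S\<^sup>2 * (s * s') + t * t')\<^sup>2"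
      using zero_le_power2[of "S\<^sup>2 * (s * s') - t * t'"] by (simp add: power2_eq_square algebra_simps)
    finally show "(2 * S * (x * y))\<^sup>2 \<le> (S\<^sup>2 * (s * s') + t * t')\<^sup>2" .
  qed (use nn S in auto)
  have k2: "0 \<le> 1 - k\<^sup>2" using k by (simp add: power_le_one)
  have "0 \<le> 2 * S * ((k * y + x) * (y - k * x))"
    using ky x y k S by auto
  also have "\<dots> = (1 - k\<^sup>2) * (2 * S * (x * y)) + 2 * k * S * (y\<^sup>2 - x\<^sup>2)"
    by (simp add: power2_eq_square algebra_simps)
  also have "\<dots> \<le> (1 - k\<^sup>2) * (S\<^sup>2 * (s * s') + t * t') + 2 * k * S * (s' * t - s * t')"
    using mult_left_mono[OF am_gm k2] x y by simp
  finally have 1: "0 \<le> (1 - k\<^sup>2) * (S\<^sup>2 * (s * s') + t * t') + 2 * k * S * (s' * t - s * t')" .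
  have 2: "0 \<le> (1 + S\<^sup>2) * (s' * t - k\<^sup>2 * (s * t'))" using cross by simp
  have "0 \<le> (S\<^sup>2 - 1) *
      ((1 - k\<^sup>2) * (S\<^sup>2 * (s * s') + t * t') + 2 * k * S * (s' * t - s * t')
        + (1 + S\<^sup>2) * (s' * t - k\<^sup>2 * (s * t')))"
    using 1 2 S by (intro mult_nonneg_nonneg) (auto simp: add_nonneg_nonneg)
  also have "\<dots> = (S + k)\<^sup>2 * ((s + t) * (S\<^sup>2 * s' + t'))
      - (S\<^sup>2 * s + t) * (s' + t') * (1 + k * S)\<^sup>2"
    by (simp add: power2_eq_square algebra_simps)
  finally show ?thesis by simp
qed

section \<open>The Hilbert metric on probability measures\<close>

text \<open>
  The infimum and the supremum of the ratio are themselves comparison constants. As both measures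
  have mass 1, they enclose 1.
\<close>

lemma hilbert_metric_extremal_ratios:
  assumes "prob_space \<mu>" "prob_space \<nu>" and comp: "comparable \<mu> \<nu>"
  obtains a b where "0 < a" "a \<le> 1" "1 \<le> b"
    "\<And>A. A \<in> sets \<mu> \<Longrightarrow> a * measure \<nu> A \<le> measure \<mu> A"
    "\<And>A. A \<in> sets \<mu> \<Longrightarrow> measure \<mu> A \<le> b * measure \<nu> A"
    "hilbert_metric \<mu> \<nu> = ereal (ln (b / a))"
proof -
  interpret M: prob_space \<mu> by fact
  interpret N: prob_space \<nu> by fact
  from comp obtain a0 b0 :: real where sets: "sets \<mu> = sets \<nu>" and ab0: "0 < a0" "a0 \<le> b0"
    and le0: "\<And>A. A \<in> sets \<nu> \<Longrightarrow> ennreal a0 * emeasure \<nu> A \<le> emeasure \<mu> A"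
      "\<And>A. A \<in> sets \<nu> \<Longrightarrow> emeasure \<mu> A \<le> ennreal b0 * emeasure \<nu> A"
    unfolding comparable_def by auto
  have le: "a0 * measure \<nu> A \<le> measure \<mu> A" "measure \<mu> A \<le> b0 * measure \<nu> A"
    if "A \<in> sets \<nu>" for A
    using le0[OF that] ab0
    by (auto simp: M.emeasure_eq_measure N.emeasure_eq_measure ennreal_mult[symmetric])
  define I where "I = {A \<in> sets \<nu>. measure \<nu> A > 0}"
  define R where "R A = measure \<mu> A / measure \<nu> A" for A
  have sp: "space \<mu> = space \<nu>" using sets by (rule sets_eq_imp_space_eq)
  have spI: "space \<nu> \<in> I" by (simp add: I_def N.prob_space)
  have R1: "R (space \<nu>) = 1" using M.prob_space by (simp add: R_def N.prob_space sp)
  have Rb: "a0 \<le> R A" "R A \<le> b0" if "A \<in> I" for A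
    using that le[of A] by (auto simp: I_def R_def field_simps)
  have bdd: "bdd_above (R ` I)" "bdd_below (R ` I)" using Rb by (auto intro!: bdd_aboveI2 bdd_belowI2)
  define a where "a = (INF A\<in>I. R A)"
  define b where "b = (SUP A\<in>I. R A)"
  have aR: "a \<le> R A" "R A \<le> b" if "A \<in> I" for A
    unfolding a_def b_def using that bdd by (auto intro: cINF_lower cSUP_upper)
  have "a0 \<le> a" unfolding a_def using spI Rb by (intro cINF_greatest) auto
  moreover have "a * measure \<nu> A \<le> measure \<mu> A" "measure \<mu> A \<le> b * measure \<nu> A"
    if "A \<in> sets \<mu>" for A
    using aR[of A] le[of A] that sets
    by (cases "measure \<nu> A = 0"; auto simp: I_def R_def field_simps zero_less_measure_iff)+
  moreover have "hilbert_metric \<mu> \<nu> = ereal (ln (b / a))"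
    using comp by (simp add: hilbert_metric_def M.emeasure_space_1 a_def b_def R_def I_def)
  ultimately show ?thesis using aR[OF spI] R1 ab0 that[of a b] by auto
qed

text \<open>
  Taking \<open>A\<close> or \<open>B\<close> to be the whole space in the cross-ratio bound gives comparability with constants
  \<open>1 / C\<close> and \<open>C\<close>.
\<close>

lemma hilbert_metric_le_ln:
  assumes "prob_space \<mu>" "prob_space \<nu>" and sets: "sets \<mu> = sets \<nu>"
    and cross: "\<And>A B. A \<in> sets \<mu> \<Longrightarrow> B \<in> sets \<mu> \<Longrightarrow>
      measure \<mu> A * measure \<nu> B \<le> C * (measure \<nu> A * measure \<mu> B)"
  shows "comparable \<mu> \<nu>" "hilbert_metric \<mu> \<nu> \<le> ereal (ln C)"
proof -
  interpret M: prob_space \<mu> by fact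
  interpret N: prob_space \<nu> by fact
  have sp: "space \<mu> = space \<nu>" using sets by (rule sets_eq_imp_space_eq)
  have p1: "measure \<mu> (space \<nu>) = 1" "measure \<nu> (space \<nu>) = 1"
    using M.prob_space N.prob_space sp by auto
  have C: "1 \<le> C" using cross[of "space \<nu>" "space \<nu>"] p1 sets by auto
  have up: "measure \<mu> A \<le> C * measure \<nu> A" if "A \<in> sets \<mu>" for A
    using cross[OF that, of "space \<nu>"] p1 sets by auto
  have low: "measure \<nu> A \<le> C * measure \<mu> A" if "A \<in> sets \<mu>" for A
    using cross[OF _ that, of "space \<nu>"] p1 sets by auto
  have C': "1 / C \<le> C" using C using order_trans[of "1 / C" 1 C] by simp
  show comp: "comparable \<mu> \<nu>"
  proof -
    have "ennreal (1 / C) * emeasure \<nu> A \<le> emeasure \<mu> A \<and>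
        emeasure \<mu> A \<le> ennreal C * emeasure \<nu> A" if "A \<in> sets \<nu>" for A
    proof -
      have "1 / C * measure \<nu> A \<le> measure \<mu> A" "measure \<mu> A \<le> C * measure \<nu> A"
        using up[of A] low[of A] C sets that by (simp_all add: divide_le_eq mult.commute)
      then show ?thesis
        using C by (simp add: M.emeasure_eq_measure N.emeasure_eq_measure ennreal_mult[symmetric])
    qed
    moreover have "0 < 1 / C" using C by simp
    ultimately show ?thesis unfolding comparable_def using C' sets by blast
  qed
  define I where "I = {A \<in> sets \<nu>. measure \<nu> A > 0}"
  define R where "R A = measure \<mu> A / measure \<nu> A" for A
  have spI: "space \<nu> \<in> I" by (simp add: I_def p1)
  have Rb: "1 / C \<le> R A" "R A \<le> C" if "A \<in> I" for A
    using that up[of A] low[of A] C sets by (auto simp: I_def R_def field_simps)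
  have RR: "R A / C \<le> R B" if "A \<in> I" "B \<in> I" for A B
    using cross[of A B] that C sets by (auto simp: I_def R_def field_simps)
  define a where "a = (INF A\<in>I. R A)"
  define b where "b = (SUP A\<in>I. R A)"
  have apos: "0 < a"
  proof -
    have "1 / C \<le> a" unfolding a_def using spI Rb by (intro cINF_greatest) auto
    moreover have "0 < 1 / C" using C by simp
    ultimately show ?thesis by linarith
  qed
  have "R A / C \<le> a" if "A \<in> I" for A
    unfolding a_def using spI RR that by (intro cINF_greatest) auto
  then have "b \<le> C * a"
    unfolding b_def using spI C by (intro cSUP_least) (auto simp: field_simps)
  moreover have "1 \<le> b"
  proof -
    have "bdd_above (R ` I)" using Rb(2) by (rule bdd_aboveI2)
    from cSUP_upper[OF spI this] show ?thesis by (simp add: b_def R_def p1)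
  qed
  ultimately have "0 < b / a" "b / a \<le> C" using apos by (simp_all add: field_simps)
  then have "ln (b / a) \<le> ln C" by simp
  then show "hilbert_metric \<mu> \<nu> \<le> ereal (ln C)"
    using comp by (simp add: hilbert_metric_def M.emeasure_space_1 a_def b_def R_def I_def)
qed

text \<open>
  Let \<open>a\<close> and \<open>b\<close> be the extremal ratios. Then \<open>\<mu>(A) - \<nu>(A)\<close> is at most \<open>1 - 1 / b \<le> ln b\<close>, and, by
  passing to complements, at most \<open>1 - a \<le> - ln a\<close>. The smaller of these two is at most their mean
  \<open>ln (b / a) / 2\<close>, which absorbs the factor 2 in the definition of total variation.
\<close>

lemma tv_dist_le_hilbert_metric:
  assumes \<mu>: "prob_space \<mu>" and \<nu>: "prob_space \<nu>" and comp: "comparable \<mu> \<nu>"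
  shows "tv_dist \<mu> \<nu> \<le> hilbert_metric \<mu> \<nu>"
proof -
  interpret M: prob_space \<mu> by fact
  interpret N: prob_space \<nu> by fact
  obtain a b where ab: "0 < a" "a \<le> 1" "1 \<le> b"
    and le: "\<And>A. A \<in> sets \<mu> \<Longrightarrow> a * measure \<nu> A \<le> measure \<mu> A"
      "\<And>A. A \<in> sets \<mu> \<Longrightarrow> measure \<mu> A \<le> b * measure \<nu> A"
    and h: "hilbert_metric \<mu> \<nu> = ereal (ln (b / a))"
    using hilbert_metric_extremal_ratios[OF assms] by metis
  have sets: "sets \<mu> = sets \<nu>" using comp by (simp add: comparable_def)
  then have sp: "space \<mu> = space \<nu>" by (rule sets_eq_imp_space_eq)
  have compl: "measure \<mu> (space \<mu> - A) = 1 - measure \<mu> A"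
    "measure \<nu> (space \<mu> - A) = 1 - measure \<nu> A" if "A \<in> sets \<mu>" for A
    using M.prob_compl[of A] N.prob_compl[of A] that unfolding sp sets by auto
  have one_sided: "measure \<mu> A - measure \<nu> A \<le> ln (b / a) / 2" if A: "A \<in> sets \<mu>" for A
  proof -
    have "measure \<mu> A / b \<le> measure \<nu> A"
      using le(2)[OF A] ab by (simp add: field_simps)
    then have "measure \<mu> A - measure \<nu> A \<le> measure \<mu> A * (1 - 1 / b)"
      by (simp add: algebra_simps)
    also have "\<dots> \<le> 1 * (1 - 1 / b)" using ab by (intro mult_right_mono) auto
    also have "\<dots> \<le> ln b" using ln_le_minus_one[of "1 / b"] ab by (simp add: ln_div)
    finally have 1: "measure \<mu> A - measure \<nu> A \<le> ln b" .
    have "a * (1 - measure \<nu> A) \<le> 1 - measure \<mu> A"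
      using le(1)[of "space \<mu> - A"] A by (simp add: compl[OF A] sets.compl_sets)
    then have "measure \<mu> A - measure \<nu> A \<le> (1 - a) * (1 - measure \<nu> A)"
      by (simp add: algebra_simps)
    also have "\<dots> \<le> (1 - a) * 1" using ab by (intro mult_left_mono) auto
    also have "\<dots> \<le> - ln a" using ln_le_minus_one[of a] ab by simp
    finally show ?thesis using 1 ab by (simp add: ln_div)
  qed
  have "\<bar>measure \<mu> A - measure \<nu> A\<bar> \<le> ln (b / a) / 2" if A: "A \<in> sets \<mu>" for A
    using one_sided[OF A] one_sided[of "space \<mu> - A"] A
    by (intro abs_leI) (simp_all add: compl[OF A] sets.compl_sets)
  then have "(SUP B\<in>sets \<mu>. ereal \<bar>measure \<mu> B - measure \<nu> B\<bar>) \<le> ereal (ln (b / a) / 2)"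
    by (intro SUP_least) simp
  from ereal_mult_left_mono[OF this, of 2] show ?thesis
    by (simp add: tv_dist_def h)
qed

section \<open>Birkhoff contraction\<close>

lemma integral_mono_measure_scaled:
  fixes f :: "'a \<Rightarrow> real"
  assumes "finite_measure \<mu>" "finite_measure \<nu>" and sets: "sets \<mu> = sets \<nu>" and c: "0 \<le> c"
    and le: "\<And>A. A \<in> sets \<mu> \<Longrightarrow> measure \<mu> A \<le> c * measure \<nu> A"
    and f: "f \<in> borel_measurable \<mu>" "\<And>x. x \<in> space \<mu> \<Longrightarrow> 0 \<le> f x" "\<And>x. x \<in> space \<mu> \<Longrightarrow> f x \<le> B"
  shows "(\<integral>x. f x \<partial>\<mu>) \<le> c * (\<integral>x. f x \<partial>\<nu>)"
proof -
  interpret M: finite_measure \<mu> by fact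
  interpret N: finite_measure \<nu> by fact
  have sp: "space \<mu> = space \<nu>" using sets by (rule sets_eq_imp_space_eq)
  have f': "f \<in> borel_measurable \<nu>" using f(1) measurable_cong_sets[OF sets refl] by blast
  have i: "integrable \<mu> f" "integrable \<nu> f"
    using f f' sp by (auto intro!: M.integrable_const_bound[where B=B] N.integrable_const_bound[where B=B])
  have "(\<integral>\<^sup>+x. ennreal (f x) \<partial>\<mu>) \<le> (\<integral>\<^sup>+x. ennreal (f x) \<partial>scale_measure (ennreal c) \<nu>)"
  proof (rule nn_integral_mono_measure)
    show "\<mu> \<le> scale_measure (ennreal c) \<nu>"
      using le c sets
      by (subst le_measure)
        (auto simp: M.emeasure_eq_measure N.emeasure_eq_measure ennreal_mult[symmetric])
  qed (use sets in auto)
  also have "\<dots> = ennreal c * (\<integral>\<^sup>+x. ennreal (f x) \<partial>\<nu>)"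
    using f' by (subst nn_integral_scale_measure) auto
  finally have "ennreal (\<integral>x. f x \<partial>\<mu>) \<le> ennreal c * ennreal (\<integral>x. f x \<partial>\<nu>)"
    using i f sp by (subst (asm) (1 2) nn_integral_eq_integral) auto
  then show ?thesis
    using c f(2) sp by (simp add: ennreal_mult'[symmetric] integral_nonneg_AE)
qed

text \<open>
  Birkhoff's theorem for the normalised positive operator with kernel \<open>\<phi>\<close>. Let \<open>a\<close> and \<open>b\<close> be the
  extremal ratios of \<open>\<mu>\<close> and \<open>\<nu>\<close>. Up to the factor \<open>b - a\<close>, both laws are combinations of the positive
  measures \<open>\<mu> - a \<nu>\<close> and \<open>b \<nu> - \<mu>\<close>: the first with weights \<open>b\<close> and \<open>a\<close>, the second with weights 1 and 1.
  The bounds on \<open>\<phi>\<close> confine the ratio of the images of these two measures to an interval whose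
  ends have quotient \<open>k\<^sup>2\<close>, and \<open>cross_ratio_le\<close> says how much oscillation can remain.
\<close>

lemma birkhoff_contraction:
  fixes \<phi> :: "'b set \<Rightarrow> 'a \<Rightarrow> real"
  assumes \<mu>: "prob_space \<mu>" and \<nu>: "prob_space \<nu>" and comp: "comparable \<mu> \<nu>"
    and \<mu>': "prob_space \<mu>'" and \<nu>': "prob_space \<nu>'" and sets': "sets \<mu>' = sets \<nu>'"
    and k: "0 < k" "k \<le> 1"
    and meas: "\<And>A. A \<in> sets \<mu>' \<Longrightarrow> \<phi> A \<in> borel_measurable \<mu>"
    and b0: "\<And>A. A \<in> sets \<mu>' \<Longrightarrow> 0 \<le> L A"
    and low: "\<And>A x. A \<in> sets \<mu>' \<Longrightarrow> x \<in> space \<mu> \<Longrightarrow> k * L A \<le> \<phi> A x"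
    and up: "\<And>A x. A \<in> sets \<mu>' \<Longrightarrow> x \<in> space \<mu> \<Longrightarrow> \<phi> A x \<le> L A"
    and c: "0 < c" "\<And>A. A \<in> sets \<mu>' \<Longrightarrow> measure \<mu>' A = c * (\<integral>x. \<phi> A x \<partial>\<mu>)"
    and d: "0 < d" "\<And>A. A \<in> sets \<mu>' \<Longrightarrow> measure \<nu>' A = d * (\<integral>x. \<phi> A x \<partial>\<nu>)"
  shows "hilbert_metric \<mu>' \<nu>' \<le> ereal ((1 - k) / (1 + k)) * hilbert_metric \<mu> \<nu>"
proof -
  interpret M: prob_space \<mu> by fact
  interpret N: prob_space \<nu> by fact
  obtain a b where ab: "0 < a" "a \<le> 1" "1 \<le> b"
    and le: "\<And>A. A \<in> sets \<mu> \<Longrightarrow> a * measure \<nu> A \<le> measure \<mu> A"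
      "\<And>A. A \<in> sets \<mu> \<Longrightarrow> measure \<mu> A \<le> b * measure \<nu> A"
    and h: "hilbert_metric \<mu> \<nu> = ereal (ln (b / a))"
    using hilbert_metric_extremal_ratios[OF \<mu> \<nu> comp] by metis
  have sets: "sets \<mu> = sets \<nu>" using comp by (simp add: comparable_def)
  then have sp: "space \<mu> = space \<nu>" by (rule sets_eq_imp_space_eq)
  \<comment> \<open>The square root clears the radicals from the extremal cross ratio.\<close>
  define S where "S = sqrt (b / a)"
  have S: "1 \<le> S" "b = a * S\<^sup>2" using ab by (auto simp: S_def)
  define p where "p A = (\<integral>x. \<phi> A x \<partial>\<mu>)" for A
  define q where "q A = (\<integral>x. \<phi> A x \<partial>\<nu>)" for A
  \<comment> \<open>\<open>s A\<close> and \<open>t A\<close> are the integrals of \<open>\<phi> A\<close> against the positive measures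
    \<open>\<mu> - a \<nu>\<close> and \<open>b \<nu> - \<mu>\<close>, of total mass \<open>1 - a\<close> and \<open>b - 1\<close>.\<close>
  define s where "s A = p A - a * q A" for A
  define t where "t A = b * q A - p A" for A
  have bounds: "k * L A * (1 - a) \<le> s A" "s A \<le> L A * (1 - a)"
      "k * L A * (b - 1) \<le> t A" "t A \<le> L A * (b - 1)" if A: "A \<in> sets \<mu>'" for A
  proof -
    have kL: "0 \<le> k * L A" using k b0[OF A] by simp
    have m\<nu>: "\<phi> A \<in> borel_measurable \<nu>"
      using meas[OF A] measurable_cong_sets[OF sets refl] by blast
    have ab\<phi>: "\<bar>\<phi> A x\<bar> \<le> L A" if "x \<in> space \<mu>" for x
      using low[OF A that] up[OF A that] kL by simp
    have i: "integrable \<mu> (\<phi> A)" "integrable \<nu> (\<phi> A)"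
      using meas[OF A] m\<nu> ab\<phi> sp
      by (auto intro!: M.integrable_const_bound[where B="L A"] N.integrable_const_bound[where B="L A"])
    have fin: "finite_measure \<mu>" "finite_measure \<nu>" by unfold_locales
    have le': "measure \<nu> B \<le> (1 / a) * measure \<mu> B" if "B \<in> sets \<nu>" for B
      using le(1)[of B] that sets ab by (simp add: field_simps)
    \<comment> \<open>Applying this to \<open>\<phi> A - k * L A\<close> and to \<open>L A - \<phi> A\<close> amounts to integrating these
      nonnegative functions against \<open>\<mu> - a \<nu>\<close> and \<open>b \<nu> - \<mu>\<close>.\<close>
    have g: "(\<integral>x. f x \<partial>\<mu>) \<le> b * (\<integral>x. f x \<partial>\<nu>)" "a * (\<integral>x. f x \<partial>\<nu>) \<le> (\<integral>x. f x \<partial>\<mu>)"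
      if f: "f \<in> borel_measurable \<mu>" "\<And>x. x \<in> space \<mu> \<Longrightarrow> 0 \<le> f x" "\<And>x. x \<in> space \<mu> \<Longrightarrow> f x \<le> B"
      for f :: "'a \<Rightarrow> real" and B
    proof -
      show "(\<integral>x. f x \<partial>\<mu>) \<le> b * (\<integral>x. f x \<partial>\<nu>)"
        using integral_mono_measure_scaled[OF fin sets _ le(2) f] ab by auto
      have "f \<in> borel_measurable \<nu>" using f(1) measurable_cong_sets[OF sets refl] by blast
      then have "(\<integral>x. f x \<partial>\<nu>) \<le> (1 / a) * (\<integral>x. f x \<partial>\<mu>)"
        using integral_mono_measure_scaled[OF fin(2,1) sets[symmetric] _ le', of f B] ab f sp by auto
      then show "a * (\<integral>x. f x \<partial>\<nu>) \<le> (\<integral>x. f x \<partial>\<mu>)" using ab by (simp add: field_simps)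
    qed
    have i1: "(\<integral>x. \<phi> A x - k * L A \<partial>\<mu>) = p A - k * L A" "(\<integral>x. \<phi> A x - k * L A \<partial>\<nu>) = q A - k * L A"
      "(\<integral>x. L A - \<phi> A x \<partial>\<mu>) = L A - p A" "(\<integral>x. L A - \<phi> A x \<partial>\<nu>) = L A - q A"
      using i by (auto simp: p_def q_def M.prob_space N.prob_space)
    have "(\<lambda>x. \<phi> A x - k * L A) \<in> borel_measurable \<mu>" "(\<lambda>x. L A - \<phi> A x) \<in> borel_measurable \<mu>"
      using meas[OF A] by auto
    note gL = g[OF this(1), of "L A"] and gU = g[OF this(2), of "L A"]
    have le_L: "\<phi> A x - k * L A \<le> L A" "L A - \<phi> A x \<le> L A" if "x \<in> space \<mu>" for x
      using low[OF A that] up[OF A that] kL by linarith+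
    have "p A - k * L A \<le> b * (q A - k * L A)" "a * (q A - k * L A) \<le> p A - k * L A"
      "L A - p A \<le> b * (L A - q A)" "a * (L A - q A) \<le> L A - p A"
      using gL gU low[OF A] up[OF A] le_L by (simp_all add: i1)
    then show "k * L A * (1 - a) \<le> s A" "s A \<le> L A * (1 - a)"
      "k * L A * (b - 1) \<le> t A" "t A \<le> L A * (b - 1)"
      by (simp_all add: s_def t_def algebra_simps)
  qed
  define F where "F = ((S + k) / (1 + k * S))\<^sup>2"
  have den: "0 < 1 + k * S" using k S by (auto intro: add_pos_pos)
  have cross: "p A * q B \<le> F * (q A * p B)" if A: "A \<in> sets \<mu>'" and B: "B \<in> sets \<mu>'" for A B
  proof (cases "a = b")
    case True
    \<comment> \<open>Here \<open>\<mu> = \<nu>\<close>, and the normalising factor \<open>b - a\<close> of the decomposition vanishes.\<close>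
    then have "a = 1" "b = 1" using ab by auto
    then have "S = 1" by (simp add: S_def)
    then have "F = 1" using den by (simp add: F_def add.commute)
    have "s X = 0" if "X \<in> sets \<mu>'" for X
      using bounds(1,2)[OF that] unfolding \<open>a = 1\<close> by simp
    from this[OF A] this[OF B] show ?thesis
      unfolding \<open>F = 1\<close> s_def \<open>a = 1\<close> by simp
  next
    case False
    then have ba: "0 < b - a" using ab by auto
    have nn: "0 \<le> s A" "0 \<le> t A" "0 \<le> s B" "0 \<le> t B"
      using order_trans[OF _ bounds(1)[OF A]] order_trans[OF _ bounds(3)[OF A]]
        order_trans[OF _ bounds(1)[OF B]] order_trans[OF _ bounds(3)[OF B]]
        b0[OF A] b0[OF B] k ab by simp_all
    have "k\<^sup>2 * (s A * t B) \<le> k\<^sup>2 * ((L A * (1 - a)) * (L B * (b - 1)))"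
      using bounds[OF A] bounds[OF B] nn b0[OF A] b0[OF B] ab
      by (intro mult_left_mono mult_mono) auto
    also have "\<dots> = (k * L B * (1 - a)) * (k * L A * (b - 1))"
      by (simp add: power2_eq_square)
    also have "\<dots> \<le> s B * t A"
      using bounds[OF A] bounds[OF B] nn b0[OF A] b0[OF B] ab k
      by (intro mult_mono) auto
    finally have kst: "k\<^sup>2 * (s A * t B) \<le> s B * t A" .
    have pq: "(b - a) * p A = a * (S\<^sup>2 * s A + t A)" "(b - a) * q A = s A + t A" for A
      by (simp_all add: s_def t_def S(2) algebra_simps)
    have "(b - a)\<^sup>2 * (p A * q B) * (1 + k * S)\<^sup>2 = ((b - a) * p A) * ((b - a) * q B) * (1 + k * S)\<^sup>2"
      by (simp add: power2_eq_square)
    also have "\<dots> = a * ((S\<^sup>2 * s A + t A) * (s B + t B) * (1 + k * S)\<^sup>2)"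
      unfolding pq by (simp add: mult.assoc)
    also have "\<dots> \<le> a * ((S + k)\<^sup>2 * ((s A + t A) * (S\<^sup>2 * s B + t B)))"
      using cross_ratio_le[OF S(1) k nn kst] ab by (intro mult_left_mono) auto
    also have "\<dots> = (S + k)\<^sup>2 * (((b - a) * q A) * ((b - a) * p B))"
      unfolding pq by simp
    also have "\<dots> = (b - a)\<^sup>2 * ((S + k)\<^sup>2 * (q A * p B))"
      by (simp add: power2_eq_square)
    finally have "p A * q B * (1 + k * S)\<^sup>2 \<le> (S + k)\<^sup>2 * (q A * p B)"
      using ba by (simp add: mult.assoc)
    then show ?thesis using den by (simp add: F_def power_divide field_simps)
  qed
  have "hilbert_metric \<mu>' \<nu>' \<le> ereal (ln F)"
  proof (rule hilbert_metric_le_ln(2)[OF \<mu>' \<nu>' sets'])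
    fix A B assume A: "A \<in> sets \<mu>'" and B: "B \<in> sets \<mu>'"
    have "c * d * (p A * q B) \<le> c * d * (F * (q A * p B))"
      using cross[OF A B] c(1) d(1) by (intro mult_left_mono) auto
    then show "measure \<mu>' A * measure \<nu>' B \<le> F * (measure \<nu>' A * measure \<mu>' B)"
      using A B by (simp add: c(2) d(2) p_def[symmetric] q_def[symmetric] mult_ac)
  qed
  also have "ln F \<le> (1 - k) / (1 + k) * ln (b / a)"
  proof -
    have "ln F = 2 * ln ((S + k) / (1 + k * S))" using den S k by (simp add: F_def ln_realpow)
    also have "\<dots> \<le> (1 - k) / (1 + k) * (2 * ln S)" 
      unfolding mult.left_commute[of _ 2] using ln_moebius_le[OF S(1) k] by (intro mult_left_mono) auto
    also have "2 * ln S = ln (b / a)" using ab by (simp add: S_def ln_sqrt)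
    finally show ?thesis .
  qed
  finally show ?thesis by (simp add: h)
qed

section \<open>The filter recursion as a uniformly mixing positive operator\<close>

text \<open>
  Since the likelihood of \<open>y\<close> is bounded away from 0, observing \<open>y\<close> has positive probability under
  every law of the state. The normalising constant is therefore a positive real number.
\<close>

lemma bayes_update_facts:
  assumes \<mu>: "\<mu> \<in> space (prob_algebra M)"
    and Q: "Q \<in> M \<rightarrow>\<^sub>M prob_algebra (count_space UNIV)"
    and e: "0 < e" "\<And>x. x \<in> space M \<Longrightarrow> e \<le> measure (Q x) {y}"
  shows "bayes_update Q y \<mu> \<in> space (prob_algebra M)"
    and "0 < (\<integral>x. measure (Q x) {y} \<partial>\<mu>)"
    and "A \<in> sets M \<Longrightarrow> measure (bayes_update Q y \<mu>) A =
      1 / (\<integral>x. measure (Q x) {y} \<partial>\<mu>) * (\<integral>x. measure (Q x) {y} * indicator A x \<partial>\<mu>)"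
proof -
  interpret M: prob_space \<mu> using \<mu> by (simp add: space_prob_algebra)
  have sets: "sets \<mu> = sets M" using \<mu> by (simp add: space_prob_algebra)
  then have sp: "space \<mu> = space M" by (rule sets_eq_imp_space_eq)
  define g where "g x = measure (Q x) {y}" for x
  have "g \<in> borel_measurable M"
    unfolding g_def using measurable_compose[OF Q measurable_measure_prob_algebra[of "{y}"]] by simp
  then have gm [measurable]: "g \<in> borel_measurable \<mu>"
    using measurable_cong_sets[OF sets refl] by blast
  have Qp: "prob_space (Q x)" if "x \<in> space M" for x
    using measurable_space[OF Q that] by (simp add: space_prob_algebra)
  have g: "e \<le> g x" "g x \<le> 1" "0 \<le> g x" "emeasure (Q x) {y} = ennreal (g x)" if "x \<in> space M" for x
  proof -
    interpret q: prob_space "Q x" by (rule Qp[OF that])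
    show "e \<le> g x" "g x \<le> 1" "0 \<le> g x" "emeasure (Q x) {y} = ennreal (g x)"
      using e(2)[OF that] by (simp_all add: g_def q.emeasure_eq_measure)
  qed
  have ig: "integrable \<mu> g"
    using g sp by (intro M.integrable_const_bound[where B=1]) auto
  define Z where "Z = (\<integral>x. g x \<partial>\<mu>)"
  have "(\<integral>x. e \<partial>\<mu>) \<le> Z"
    unfolding Z_def using ig g sp by (intro integral_mono) auto
  then have Z: "0 < Z" using e(1) by (simp add: M.prob_space)
  have nnZ: "(\<integral>\<^sup>+x. emeasure (Q x) {y} \<partial>\<mu>) = ennreal Z"
  proof -
    have "(\<integral>\<^sup>+x. emeasure (Q x) {y} \<partial>\<mu>) = (\<integral>\<^sup>+x. ennreal (g x) \<partial>\<mu>)"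
      using g sp by (intro nn_integral_cong) auto
    also have "\<dots> = ennreal Z"
      unfolding Z_def using ig g sp by (intro nn_integral_eq_integral) auto
    finally show ?thesis .
  qed
  have dens: "bayes_update Q y \<mu> = density \<mu> (\<lambda>x. ennreal (g x / Z))"
  proof -
    have "(\<lambda>x. emeasure (Q x) {y}) \<in> borel_measurable M"
      using measurable_compose[OF measurable_prob_algebraD[OF Q] measurable_emeasure_subprob_algebra[of "{y}"]]
      by simp
    then have [measurable]: "(\<lambda>x. emeasure (Q x) {y}) \<in> borel_measurable \<mu>"
      using measurable_cong_sets[OF sets refl] by blast
    show ?thesis
      unfolding bayes_update_def nnZ using g sp Z
      by (intro density_cong) (auto simp: divide_ennreal)
  qed
  have em: "emeasure (bayes_update Q y \<mu>) A = ennreal (1 / Z * (\<integral>x. g x * indicator A x \<partial>\<mu>))"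
    if A: "A \<in> sets M" for A
  proof -
    have [measurable]: "A \<in> sets \<mu>" using A sets by simp
    have i: "integrable \<mu> (\<lambda>x. 1 / Z * (g x * indicator A x))"
      using integrable_real_mult_indicator[OF \<open>A \<in> sets \<mu>\<close> ig] by simp
    have "emeasure (bayes_update Q y \<mu>) A = (\<integral>\<^sup>+x. ennreal (g x / Z) * indicator A x \<partial>\<mu>)"
      unfolding dens by (intro emeasure_density) auto
    also have "\<dots> = (\<integral>\<^sup>+x. ennreal (1 / Z * (g x * indicator A x)) \<partial>\<mu>)"
      by (intro nn_integral_cong) (auto split: split_indicator)
    also have "\<dots> = ennreal (\<integral>x. 1 / Z * (g x * indicator A x) \<partial>\<mu>)"
      using i g sp Z by (intro nn_integral_eq_integral) (auto split: split_indicator)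
    also have "(\<integral>x. 1 / Z * (g x * indicator A x) \<partial>\<mu>) = 1 / Z * (\<integral>x. g x * indicator A x \<partial>\<mu>)"
      by (rule integral_mult_right_zero)
    finally show ?thesis .
  qed
  show "0 < (\<integral>x. measure (Q x) {y} \<partial>\<mu>)" using Z by (simp add: Z_def g_def)
  have nn: "0 \<le> (\<integral>x. g x * indicator A x \<partial>\<mu>)" for A
    using g sp by (intro integral_nonneg_AE AE_I2) (auto split: split_indicator)
  show "measure (bayes_update Q y \<mu>) A =
      1 / (\<integral>x. measure (Q x) {y} \<partial>\<mu>) * (\<integral>x. measure (Q x) {y} * indicator A x \<partial>\<mu>)"
    if "A \<in> sets M"
    using em[OF that] Z nn[of A] by (simp add: measure_def Z_def g_def)
  have "(\<integral>x. g x * indicator (space M) x \<partial>\<mu>) = Z"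
    unfolding Z_def using sp by (intro Bochner_Integration.integral_cong) auto
  then have "emeasure (bayes_update Q y \<mu>) (space M) = 1"
    using em[OF sets.top] Z by simp
  then show "bayes_update Q y \<mu> \<in> space (prob_algebra M)"
    using sets sp by (auto simp: space_prob_algebra dens intro!: prob_spaceI)
qed

lemma bind_in_prob_algebra:
  assumes "\<mu> \<in> space (prob_algebra M)" "K \<in> M \<rightarrow>\<^sub>M prob_algebra M"
  shows "\<mu> \<bind> K \<in> space (prob_algebra M)"
  using prob_space_bind'[OF assms] sets_bind'[OF assms] by (simp add: space_prob_algebra)

text \<open>
  The numerator of the Bayes formula is linear in \<open>\<mu>\<close>, with \<open>\<phi> A x = \<integral>\<^sub>A Q(y|z) K(x,dz)\<close>. The bounds on
  \<open>Q\<close> place \<open>\<phi> A x\<close> between \<open>e K(x,A)\<close> and \<open>K(x,A)\<close>, and mixing places \<open>K(x,A)\<close> between \<open>\<delta> \<Lambda>(A)\<close> and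
  \<open>\<Lambda>(A) / \<delta>\<close>. So \<open>L A = \<Lambda>(A) / \<delta>\<close> bounds \<open>\<phi> A\<close> from above, and \<open>\<delta>\<^sup>2 e L A\<close> bounds it from below. Only
  the constant \<open>c\<close> depends on \<open>\<mu>\<close>.
\<close>

lemma filter_step_representation:
  assumes K: "K \<in> M \<rightarrow>\<^sub>M prob_algebra M" and mix: "mixing_kernel M \<delta> K"
    and Q: "Q \<in> M \<rightarrow>\<^sub>M prob_algebra (count_space UNIV)"
    and e: "0 < e" "\<And>x. x \<in> space M \<Longrightarrow> e \<le> measure (Q x) {y}"
  obtains \<phi> L where
    "\<And>A. A \<in> sets M \<Longrightarrow> \<phi> A \<in> borel_measurable M"
    "\<And>A. 0 \<le> (L A :: real)"
    "\<And>A x. A \<in> sets M \<Longrightarrow> x \<in> space M \<Longrightarrow> \<delta>\<^sup>2 * e * L A \<le> \<phi> A x"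
    "\<And>A x. A \<in> sets M \<Longrightarrow> x \<in> space M \<Longrightarrow> \<phi> A x \<le> L A"
    "\<And>\<mu>. \<mu> \<in> space (prob_algebra M) \<Longrightarrow>
      \<exists>c>0. \<forall>A\<in>sets M. measure (bayes_update Q y (\<mu> \<bind> K)) A = c * (\<integral>x. \<phi> A x \<partial>\<mu>)"
proof -
  from mix obtain \<Lambda> where \<delta>: "0 < \<delta>" "\<delta> \<le> 1" and \<Lambda>: "sets \<Lambda> = sets M"
    and mixA: "\<And>x A. x \<in> space M \<Longrightarrow> A \<in> sets M \<Longrightarrow> ennreal \<delta> * emeasure \<Lambda> A \<le> emeasure (K x) A"
      "\<And>x A. x \<in> space M \<Longrightarrow> A \<in> sets M \<Longrightarrow> emeasure (K x) A \<le> ennreal (1 / \<delta>) * emeasure \<Lambda> A"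
    unfolding mixing_kernel_def by blast
  define g where "g x = measure (Q x) {y}" for x
  define \<phi> where "\<phi> A x = (\<integral>z. g z * indicator A z \<partial>K x)" for A x
  have gm [measurable]: "g \<in> borel_measurable M"
    unfolding g_def using measurable_compose[OF Q measurable_measure_prob_algebra[of "{y}"]] by simp
  have g: "e \<le> g x" "g x \<le> 1" if "x \<in> space M" for x
  proof -
    have "prob_space (Q x)" using measurable_space[OF Q that] by (simp add: space_prob_algebra)
    then show "e \<le> g x" "g x \<le> 1"
      using e(2)[OF that] by (simp_all add: g_def prob_space.prob_le_1)
  qed
  have Kx: "prob_space (K x)" "sets (K x) = sets M" "space (K x) = space M" if "x \<in> space M" for x
    using measurable_space[OF K that] by (auto simp: space_prob_algebra dest: sets_eq_imp_space_eq)
  have real_mix: "\<delta> * measure \<Lambda> A \<le> measure (K x) A" "measure (K x) A \<le> measure \<Lambda> A / \<delta>"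
    if x: "x \<in> space M" and A: "A \<in> sets M" for x A
  proof -
    interpret k: prob_space "K x" by (rule Kx[OF x])
    \<comment> \<open>The mixing measure is finite because it is dominated by the probability measure \<open>K x\<close>.\<close>
    have "emeasure \<Lambda> A \<noteq> \<infinity>"
    proof
      assume "emeasure \<Lambda> A = \<infinity>"
      then have "emeasure (K x) A = \<infinity>"
        using mixA(1)[OF x A] \<delta> by (simp add: ennreal_mult_top top_unique)
      then show False by simp
    qed
    then have "emeasure \<Lambda> A = ennreal (measure \<Lambda> A)"
      by (simp add: emeasure_eq_ennreal_measure)
    then show "\<delta> * measure \<Lambda> A \<le> measure (K x) A" "measure (K x) A \<le> measure \<Lambda> A / \<delta>"
      using mixA[OF x A] \<delta>
      by (simp_all add: k.emeasure_eq_measure ennreal_mult'[symmetric])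
  qed
  have \<phi>b: "e * measure (K x) A \<le> \<phi> A x" "\<phi> A x \<le> measure (K x) A"
    if x: "x \<in> space M" and A: "A \<in> sets M" for x A
  proof -
    interpret k: prob_space "K x" by (rule Kx[OF x])
    have A' [measurable]: "A \<in> sets (K x)" using A Kx[OF x] by simp
    have [measurable]: "g \<in> borel_measurable (K x)"
      using gm measurable_cong_sets[OF Kx(2)[OF x] refl] by blast
    have "integrable (K x) g"
      using g order_trans[OF less_imp_le[OF e(1)] g(1)] Kx(3)[OF x]
      by (intro k.integrable_const_bound[where B=1]) auto
    then have i: "integrable (K x) (\<lambda>z. g z * indicator A z)"
      using integrable_real_mult_indicator[OF A'] by blast
    have ii: "integrable (K x) (\<lambda>z. indicator A z :: real)"
      by (intro k.integrable_const_bound[where B=1]) (auto split: split_indicator)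
    have "(\<integral>z. e * indicator A z \<partial>K x) \<le> \<phi> A x"
      unfolding \<phi>_def using i ii g Kx(3)[OF x] by (intro integral_mono) (auto split: split_indicator)
    then show "e * measure (K x) A \<le> \<phi> A x" using A' by simp
    have "\<phi> A x \<le> (\<integral>z. indicator A z \<partial>K x)"
      unfolding \<phi>_def using i ii g Kx(3)[OF x] by (intro integral_mono) (auto split: split_indicator)
    then show "\<phi> A x \<le> measure (K x) A" using A' by simp
  qed
  show ?thesis
  proof (rule that[of \<phi> "\<lambda>A. measure \<Lambda> A / \<delta>"])
    fix A assume A [measurable]: "A \<in> sets M"
    show "\<phi> A \<in> borel_measurable M"
      unfolding \<phi>_def
      by (rule measurable_compose[OF measurable_prob_algebraD[OF K] integral_measurable_subprob_algebra]) measurable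
    fix x assume x: "x \<in> space M"
    have "\<delta>\<^sup>2 * e * (measure \<Lambda> A / \<delta>) = e * (\<delta> * measure \<Lambda> A)"
      using \<delta> by (simp add: power2_eq_square)
    also have "\<dots> \<le> e * measure (K x) A" using real_mix[OF x A] e(1) by simp
    also have "\<dots> \<le> \<phi> A x" by (rule \<phi>b[OF x A])
    finally show "\<delta>\<^sup>2 * e * (measure \<Lambda> A / \<delta>) \<le> \<phi> A x" .
    show "\<phi> A x \<le> measure \<Lambda> A / \<delta>" using \<phi>b[OF x A] real_mix[OF x A] by simp
  next
    fix \<mu> assume \<mu>: "\<mu> \<in> space (prob_algebra M)"
    have sets: "sets \<mu> = sets M" and P: "prob_space \<mu>" using \<mu> by (auto simp: space_prob_algebra)
    have b: "\<mu> \<bind> K \<in> space (prob_algebra M)" by (rule bind_in_prob_algebra[OF \<mu> K])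
    note upd = bayes_update_facts[OF b Q e]
    have "(\<integral>x. g x * indicator A x \<partial>(\<mu> \<bind> K)) = (\<integral>x. \<phi> A x \<partial>\<mu>)" if A [measurable]: "A \<in> sets M" for A
      unfolding \<phi>_def
    proof (rule integral_bind[where K=M and B=1 and B'=1])
      show "K \<in> \<mu> \<rightarrow>\<^sub>M subprob_algebra M"
        using measurable_prob_algebraD[OF K] measurable_cong_sets[OF sets refl] by blast
      show "finite_measure \<mu>" using P by (simp add: prob_space.finite_measure)
      show "(\<lambda>x. g x * indicator A x) \<in> borel_measurable M" by measurable
      show "\<bar>g x * indicator A x\<bar> \<le> 1" if "x \<in> space M" for x
        using g[OF that] e(1) by (auto split: split_indicator)
      show "AE x in \<mu>. emeasure (K x) (space (K x)) \<le> ennreal 1"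
        using prob_space.emeasure_space_1[OF Kx(1)] sets_eq_imp_space_eq[OF sets] by (intro AE_I2) simp
    qed
    then show "\<exists>c>0. \<forall>A\<in>sets M. measure (bayes_update Q y (\<mu> \<bind> K)) A = c * (\<integral>x. \<phi> A x \<partial>\<mu>)"
      using upd(2,3) by (intro exI[of _ "1 / (\<integral>x. g x \<partial>(\<mu> \<bind> K))"]) (auto simp: g_def)
  qed (use \<delta> in simp)
qed

lemma filter_step_contraction:
  assumes K: "K \<in> M \<rightarrow>\<^sub>M prob_algebra M" and mix: "mixing_kernel M \<delta> K"
    and Q: "Q \<in> M \<rightarrow>\<^sub>M prob_algebra (count_space UNIV)"
    and e: "0 < e" "e \<le> 1" "\<And>x. x \<in> space M \<Longrightarrow> e \<le> measure (Q x) {y}"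
    and \<mu>: "\<mu> \<in> space (prob_algebra M)" and \<nu>: "\<nu> \<in> space (prob_algebra M)"
    and comp: "comparable \<mu> \<nu>"
  shows "hilbert_metric (bayes_update Q y (\<mu> \<bind> K)) (bayes_update Q y (\<nu> \<bind> K))
    \<le> ereal ((1 - \<delta>\<^sup>2 * e) / (1 + \<delta>\<^sup>2 * e)) * hilbert_metric \<mu> \<nu>"
proof -
  have \<delta>: "0 < \<delta>" "\<delta> \<le> 1" using mix by (auto simp: mixing_kernel_def)
  obtain \<phi> L where \<phi>:
    "\<And>A. A \<in> sets M \<Longrightarrow> \<phi> A \<in> borel_measurable M"
    "\<And>A. 0 \<le> (L A :: real)"
    "\<And>A x. A \<in> sets M \<Longrightarrow> x \<in> space M \<Longrightarrow> \<delta>\<^sup>2 * e * L A \<le> \<phi> A x"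
    "\<And>A x. A \<in> sets M \<Longrightarrow> x \<in> space M \<Longrightarrow> \<phi> A x \<le> L A"
    "\<And>\<mu>. \<mu> \<in> space (prob_algebra M) \<Longrightarrow>
      \<exists>c>0. \<forall>A\<in>sets M. measure (bayes_update Q y (\<mu> \<bind> K)) A = c * (\<integral>x. \<phi> A x \<partial>\<mu>)"
    using filter_step_representation[OF K mix Q e(1,3)] by blast
  obtain c where c: "0 < c"
    "\<And>A. A \<in> sets M \<Longrightarrow> measure (bayes_update Q y (\<mu> \<bind> K)) A = c * (\<integral>x. \<phi> A x \<partial>\<mu>)"
    using \<phi>(5)[OF \<mu>] by blast
  obtain d where d: "0 < d"
    "\<And>A. A \<in> sets M \<Longrightarrow> measure (bayes_update Q y (\<nu> \<bind> K)) A = d * (\<integral>x. \<phi> A x \<partial>\<nu>)"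
    using \<phi>(5)[OF \<nu>] by blast
  have \<mu>': "prob_space \<mu>" "sets \<mu> = sets M" "space \<mu> = space M"
    and \<nu>': "prob_space \<nu>" "sets \<nu> = sets M"
    using \<mu> \<nu> by (auto simp: space_prob_algebra dest: sets_eq_imp_space_eq)
  have "bayes_update Q y (\<mu> \<bind> K) \<in> space (prob_algebra M)"
    "bayes_update Q y (\<nu> \<bind> K) \<in> space (prob_algebra M)"
    using bayes_update_facts(1)[OF bind_in_prob_algebra[OF _ K] Q e(1,3)] \<mu> \<nu> by auto
  then have upd: "prob_space (bayes_update Q y (\<mu> \<bind> K))" "prob_space (bayes_update Q y (\<nu> \<bind> K))"
    "sets (bayes_update Q y (\<mu> \<bind> K)) = sets M" "sets (bayes_update Q y (\<nu> \<bind> K)) = sets M"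
    by (auto simp: space_prob_algebra)
  have "\<delta>\<^sup>2 * e \<le> 1 * 1" using \<delta> e by (intro mult_mono) (auto simp: power_le_one)
  then show ?thesis
    using \<phi> c d upd \<mu>' \<delta> e(1) measurable_cong_sets[OF \<mu>'(2) refl, of borel]
    by (intro birkhoff_contraction[where \<phi>=\<phi> and L=L and c=c and d=d, OF \<mu>'(1) \<nu>'(1) comp upd(1,2)]) auto
qed

text \<open>
  Whatever the two priors are, the unnormalised posterior masses of \<open>A\<close> are averages of \<open>\<phi> A\<close>, hence
  both lie in \<open>[k L A, L A]\<close> with \<open>k = \<delta>\<^sup>2 e\<close>. A cross ratio of four such masses is at most \<open>1 / k\<^sup>2\<close>, and
  the normalising constants cancel in it.
\<close>

lemma filter_step_bounded:
  assumes K: "K \<in> M \<rightarrow>\<^sub>M prob_algebra M" and mix: "mixing_kernel M \<delta> K"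
    and Q: "Q \<in> M \<rightarrow>\<^sub>M prob_algebra (count_space UNIV)"
    and e: "0 < e" "\<And>x. x \<in> space M \<Longrightarrow> e \<le> measure (Q x) {y}"
    and \<mu>: "\<mu> \<in> space (prob_algebra M)" and \<nu>: "\<nu> \<in> space (prob_algebra M)"
  shows "comparable (bayes_update Q y (\<mu> \<bind> K)) (bayes_update Q y (\<nu> \<bind> K))"
    and "hilbert_metric (bayes_update Q y (\<mu> \<bind> K)) (bayes_update Q y (\<nu> \<bind> K))
      \<le> ereal (ln (1 / (\<delta>\<^sup>2 * e)\<^sup>2))"
proof -
  have \<delta>: "0 < \<delta>" "\<delta> \<le> 1" using mix by (auto simp: mixing_kernel_def)
  define k where "k = \<delta>\<^sup>2 * e"
  have k: "0 < k" using \<delta> e by (simp add: k_def)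
  obtain \<phi> L where \<phi>:
    "\<And>A. A \<in> sets M \<Longrightarrow> \<phi> A \<in> borel_measurable M"
    "\<And>A. 0 \<le> (L A :: real)"
    "\<And>A x. A \<in> sets M \<Longrightarrow> x \<in> space M \<Longrightarrow> k * L A \<le> \<phi> A x"
    "\<And>A x. A \<in> sets M \<Longrightarrow> x \<in> space M \<Longrightarrow> \<phi> A x \<le> L A"
    "\<And>\<mu>. \<mu> \<in> space (prob_algebra M) \<Longrightarrow>
      \<exists>c>0. \<forall>A\<in>sets M. measure (bayes_update Q y (\<mu> \<bind> K)) A = c * (\<integral>x. \<phi> A x \<partial>\<mu>)"
    using filter_step_representation[OF K mix Q e] unfolding k_def by blast
  obtain c where c: "0 < c"
    "\<And>A. A \<in> sets M \<Longrightarrow> measure (bayes_update Q y (\<mu> \<bind> K)) A = c * (\<integral>x. \<phi> A x \<partial>\<mu>)"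
    using \<phi>(5)[OF \<mu>] by blast
  obtain d where d: "0 < d"
    "\<And>A. A \<in> sets M \<Longrightarrow> measure (bayes_update Q y (\<nu> \<bind> K)) A = d * (\<integral>x. \<phi> A x \<partial>\<nu>)"
    using \<phi>(5)[OF \<nu>] by blast
  have "bayes_update Q y (\<mu> \<bind> K) \<in> space (prob_algebra M)"
    "bayes_update Q y (\<nu> \<bind> K) \<in> space (prob_algebra M)"
    using bayes_update_facts(1)[OF bind_in_prob_algebra[OF _ K] Q e] \<mu> \<nu> by auto
  then have upd: "prob_space (bayes_update Q y (\<mu> \<bind> K))" "prob_space (bayes_update Q y (\<nu> \<bind> K))"
    "sets (bayes_update Q y (\<mu> \<bind> K)) = sets M" "sets (bayes_update Q y (\<nu> \<bind> K)) = sets M"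
    by (auto simp: space_prob_algebra)
  have avg: "k * L A \<le> (\<integral>x. \<phi> A x \<partial>\<rho>)" "(\<integral>x. \<phi> A x \<partial>\<rho>) \<le> L A"
    if \<rho>: "\<rho> \<in> space (prob_algebra M)" and A: "A \<in> sets M" for \<rho> A
  proof -
    interpret R: prob_space \<rho> using \<rho> by (simp add: space_prob_algebra)
    have sets: "sets \<rho> = sets M" using \<rho> by (simp add: space_prob_algebra)
    then have sp: "space \<rho> = space M" by (rule sets_eq_imp_space_eq)
    have "\<phi> A \<in> borel_measurable \<rho>"
      using \<phi>(1)[OF A] measurable_cong_sets[OF sets refl] by blast
    moreover have "\<bar>\<phi> A x\<bar> \<le> L A" if "x \<in> space M" for x
      using \<phi>(3,4)[OF A that] \<phi>(2)[of A] k by (smt (verit) mult_nonneg_nonneg)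
    ultimately have i: "integrable \<rho> (\<phi> A)"
      using sp by (intro R.integrable_const_bound[where B="L A"]) auto
    have "(\<integral>x. k * L A \<partial>\<rho>) \<le> (\<integral>x. \<phi> A x \<partial>\<rho>)" "(\<integral>x. \<phi> A x \<partial>\<rho>) \<le> (\<integral>x. L A \<partial>\<rho>)"
      using i \<phi>(3,4)[OF A] sp by (intro integral_mono; simp)+
    then show "k * L A \<le> (\<integral>x. \<phi> A x \<partial>\<rho>)" "(\<integral>x. \<phi> A x \<partial>\<rho>) \<le> L A"
      by (simp_all add: R.prob_space)
  qed
  have cross: "measure (bayes_update Q y (\<mu> \<bind> K)) A * measure (bayes_update Q y (\<nu> \<bind> K)) B
    \<le> 1 / k\<^sup>2 * (measure (bayes_update Q y (\<nu> \<bind> K)) A * measure (bayes_update Q y (\<mu> \<bind> K)) B)"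
    if "A \<in> sets (bayes_update Q y (\<mu> \<bind> K))" "B \<in> sets (bayes_update Q y (\<mu> \<bind> K))" for A B
  proof -
    have A: "A \<in> sets M" and B: "B \<in> sets M" using that upd by auto
    note bs = avg[OF \<mu> A] avg[OF \<mu> B] avg[OF \<nu> A] avg[OF \<nu> B]
    have L: "0 \<le> L A" "0 \<le> L B" "0 \<le> k * L A" "0 \<le> k * L B" using \<phi>(2) k by auto
    have "(\<integral>x. \<phi> A x \<partial>\<mu>) * (\<integral>x. \<phi> B x \<partial>\<nu>) \<le> L A * L B"
      using bs L by (intro mult_mono) linarith+
    also have "\<dots> = 1 / k\<^sup>2 * ((k * L A) * (k * L B))" using k by (simp add: power2_eq_square)
    also have "\<dots> \<le> 1 / k\<^sup>2 * ((\<integral>x. \<phi> A x \<partial>\<nu>) * (\<integral>x. \<phi> B x \<partial>\<mu>))"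
      using bs L by (intro mult_left_mono mult_mono) (linarith | simp)+
    finally have "c * d * ((\<integral>x. \<phi> A x \<partial>\<mu>) * (\<integral>x. \<phi> B x \<partial>\<nu>))
        \<le> c * d * (1 / k\<^sup>2 * ((\<integral>x. \<phi> A x \<partial>\<nu>) * (\<integral>x. \<phi> B x \<partial>\<mu>)))"
      using c(1) d(1) by (intro mult_left_mono) auto
    then show ?thesis by (simp add: c(2)[OF A] c(2)[OF B] d(2)[OF A] d(2)[OF B] mult_ac)
  qed
  show "comparable (bayes_update Q y (\<mu> \<bind> K)) (bayes_update Q y (\<nu> \<bind> K))"
    using hilbert_metric_le_ln(1)[OF upd(1,2) _ cross] upd by simp
  show "hilbert_metric (bayes_update Q y (\<mu> \<bind> K)) (bayes_update Q y (\<nu> \<bind> K))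
      \<le> ereal (ln (1 / (\<delta>\<^sup>2 * e)\<^sup>2))"
    using hilbert_metric_le_ln(2)[OF upd(1,2) _ cross] upd unfolding k_def by simp
qed

section \<open>Geometric stability of the filter\<close>

theorem theorem3:
  fixes M :: "'a measure"
    and T :: "'a \<times> 'u::finite \<Rightarrow> 'a measure"
    and Q :: "'a \<Rightarrow> 'y::finite measure"
    and zs :: "'a measure"
    and \<epsilon> :: real
    and \<epsilon>u :: "'u \<Rightarrow> real"
  assumes "standard_borel M"
    and "T \<in> M \<Otimes>\<^sub>M count_space UNIV \<rightarrow>\<^sub>M prob_algebra M"
    and "Q \<in> M \<rightarrow>\<^sub>M prob_algebra (count_space UNIV)"
    and "\<epsilon> > 0"
    and "\<And>x y. x \<in> space M \<Longrightarrow> measure (Q x) {y} \<ge> \<epsilon>"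
    and "\<And>u. mixing_kernel M (\<epsilon>u u) (\<lambda>x. T (x, u))"
    and "zs \<in> space (prob_algebra M)"
  shows "\<exists>r K :: real.
     r < 1 \<and>
     r = (SUP u. (1 - (\<epsilon>u u)\<^sup>2 * \<epsilon>) / (1 + (\<epsilon>u u)\<^sup>2 * \<epsilon>)) \<and>
     ereal K = ereal (2 / ln 3) *
       (SUP z\<in>space (prob_algebra M). SUP y. SUP u.
          hilbert_metric (posterior T Q z y u 1) (posterior T Q zs y u 1)) \<and>
     (\<forall>N\<ge>1. L_TV M T Q zs N \<le> ereal (r ^ (N - 1) * K))"
proof -
  note T = assms(2) and Q = assms(3) and e = assms(4,5) and mix = assms(6) and zs = assms(7)
  have K: "(\<lambda>x. T (x, u)) \<in> M \<rightarrow>\<^sub>M prob_algebra M" for u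
    by (rule measurable_Pair1[OF T]) simp
  have \<epsilon>u: "0 < \<epsilon>u u" "\<epsilon>u u \<le> 1" for u using mix[of u] by (auto simp: mixing_kernel_def)
  have "\<epsilon> \<le> 1"
  proof -
    have "prob_space zs" "space zs = space M"
      using zs by (auto simp: space_prob_algebra dest: sets_eq_imp_space_eq)
    then obtain x where x: "x \<in> space M" using prob_space.not_empty by blast
    then have "prob_space (Q x)" using measurable_space[OF Q] by (auto simp: space_prob_algebra)
    then show ?thesis using e(2)[OF x] prob_space.prob_le_1 order_trans by blast
  qed
  define k where "k u = (\<epsilon>u u)\<^sup>2 * \<epsilon>" for u
  have k: "0 < k u" "k u \<le> 1" for u
  proof -
    show "0 < k u" using \<epsilon>u[of u] e(1) by (simp add: k_def)
    have "(\<epsilon>u u)\<^sup>2 * \<epsilon> \<le> 1 * 1"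
      using \<epsilon>u[of u] e(1) \<open>\<epsilon> \<le> 1\<close> by (intro mult_mono) (auto simp: power_le_one)
    then show "k u \<le> 1" by (simp add: k_def)
  qed
  define \<tau> where "\<tau> u = (1 - k u) / (1 + k u)" for u
  have \<tau>: "0 \<le> \<tau> u" "\<tau> u < 1" for u using k[of u] by (simp_all add: \<tau>_def)
  define r where "r = (SUP u. \<tau> u)"
  have \<tau>r: "\<tau> u \<le> r" for u unfolding r_def by (intro cSUP_upper) auto
  have r: "0 \<le> r" "r < 1"
  proof -
    have "r \<in> range \<tau>" unfolding r_def by (subst cSup_eq_Max) (auto intro!: Max_in)
    then show "0 \<le> r" "r < 1" using \<tau> by auto
  qed
  define \<pi> where "\<pi> z y u n = posterior T Q z y u n" for z y u n
  have post: "\<pi> z y u n \<in> space (prob_algebra M)" if "z \<in> space (prob_algebra M)" for z y u n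
  proof (induction n)
    case 0
    show ?case unfolding \<pi>_def posterior.simps by (rule bayes_update_facts(1)[OF that Q e])
  next
    case (Suc n)
    then show ?case unfolding \<pi>_def posterior.simps
      by (intro bayes_update_facts(1)[OF _ Q e] bind_in_prob_algebra K)
  qed
  have comp: "comparable (\<pi> z y u (Suc n)) (\<pi> zs y u (Suc n))"
    and hb: "hilbert_metric (\<pi> z y u (Suc n)) (\<pi> zs y u (Suc n)) \<le> ereal (ln (1 / (k (u n))\<^sup>2))"
    if z: "z \<in> space (prob_algebra M)" for z y u n
    using filter_step_bounded[OF K mix Q e, of "\<pi> z y u n" "\<pi> zs y u n" "y (Suc n)" "u n"]
      post[OF z] post[OF zs]
    by (simp_all add: \<pi>_def k_def)
  have prob: "prob_space (\<pi> z y u n)" if "z \<in> space (prob_algebra M)" for z y u n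
    using post[OF that] by (simp add: space_prob_algebra)
  have h_nonneg: "0 \<le> hilbert_metric (\<pi> z y u (Suc n)) (\<pi> zs y u (Suc n))"
    if z: "z \<in> space (prob_algebra M)" for z y u n
  proof -
    obtain a b where ab: "0 < a" "a \<le> 1" "1 \<le> b"
      "hilbert_metric (\<pi> z y u (Suc n)) (\<pi> zs y u (Suc n)) = ereal (ln (b / a))"
      using hilbert_metric_extremal_ratios[OF prob[OF z] prob[OF zs] comp[OF z]] by metis
    then show ?thesis by simp
  qed
  define H where "H z y u = hilbert_metric (\<pi> z y u 1) (\<pi> zs y u 1)" for z y u
  define S where "S = (SUP z\<in>space (prob_algebra M). SUP y. SUP u. H z y u)"
  have HS: "H z y u \<le> S" if "z \<in> space (prob_algebra M)" for z y u
    unfolding S_def using that by (auto intro!: SUP_upper2[where i=z] SUP_upper2[where i=y] SUP_upper2[where i=u])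
  have "S \<le> ereal (MAX u. ln (1 / (k u)\<^sup>2))"
    unfolding S_def
  proof (intro SUP_least)
    fix z y u assume z: "z \<in> space (prob_algebra M)"
    have "H z y u \<le> ereal (ln (1 / (k (u 0))\<^sup>2))" using hb[OF z, of y u 0] by (simp add: H_def)
    also have "\<dots> \<le> ereal (MAX u. ln (1 / (k u)\<^sup>2))" by simp
    finally show "H z y u \<le> ereal (MAX u. ln (1 / (k u)\<^sup>2))" .
  qed
  moreover have "0 \<le> S"
    using order_trans[OF h_nonneg[OF zs, of undefined undefined 0] HS[OF zs, of undefined undefined, unfolded H_def One_nat_def]] .
  ultimately obtain s where s: "S = ereal s" "0 \<le> s" by (cases S) auto
  have step: "hilbert_metric (\<pi> z y u (Suc n)) (\<pi> zs y u (Suc n)) \<le> ereal (r ^ n * s)"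
    if z: "z \<in> space (prob_algebra M)" for z y u n
  proof (induction n)
    case 0
    show ?case using HS[OF z, of y u] by (simp add: H_def s(1))
  next
    case (Suc n)
    have "hilbert_metric (\<pi> z y u (Suc (Suc n))) (\<pi> zs y u (Suc (Suc n)))
        \<le> ereal (\<tau> (u (Suc n))) * hilbert_metric (\<pi> z y u (Suc n)) (\<pi> zs y u (Suc n))"
      using filter_step_contraction[OF K[of "u (Suc n)"] mix Q e(1) \<open>\<epsilon> \<le> 1\<close> e(2)
          post[OF z] post[OF zs] comp[OF z, of y u n]]
      by (simp add: \<pi>_def \<tau>_def k_def)
    also have "\<dots> \<le> ereal r * hilbert_metric (\<pi> z y u (Suc n)) (\<pi> zs y u (Suc n))"
      using \<tau>r h_nonneg[OF z] by (intro ereal_mult_right_mono) auto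
    also have "\<dots> \<le> ereal r * ereal (r ^ n * s)"
      using Suc r by (intro ereal_mult_left_mono) auto
    finally show ?case by (simp add: mult.assoc)
  qed
  have ln3: "1 \<le> 2 / ln (3 :: real)"
    using ln_le_minus_one[of "3 :: real"] ln_gt_zero[of "3 :: real"] by simp
  have bound: "L_TV M T Q zs N \<le> ereal (r ^ (N - 1) * (2 / ln 3 * s))" if N: "1 \<le> N" for N
  proof -
    obtain n where n: "N = Suc n" using N by (cases N) auto
    have le: "r ^ n * s \<le> r ^ n * (2 / ln 3 * s)"
      using mult_right_mono[OF ln3 s(2)] r by (intro mult_left_mono) auto
    show ?thesis
      unfolding L_TV_def n
    proof (intro SUP_least)
      fix z y u assume z: "z \<in> space (prob_algebra M)"
      have "tv_dist (\<pi> z y u (Suc n)) (\<pi> zs y u (Suc n))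
          \<le> hilbert_metric (\<pi> z y u (Suc n)) (\<pi> zs y u (Suc n))"
        by (rule tv_dist_le_hilbert_metric[OF prob[OF z] prob[OF zs] comp[OF z]])
      also have "\<dots> \<le> ereal (r ^ n * s)" by (rule step[OF z])
      also have "\<dots> \<le> ereal (r ^ n * (2 / ln 3 * s))" using le by simp
      finally show "tv_dist (posterior T Q z y u (Suc n)) (posterior T Q zs y u (Suc n))
          \<le> ereal (r ^ (Suc n - 1) * (2 / ln 3 * s))"
        by (simp add: \<pi>_def)
    qed
  qed
  show ?thesis
  proof (intro exI conjI)
    show "r < 1" by (rule r)
    show "r = (SUP u. (1 - (\<epsilon>u u)\<^sup>2 * \<epsilon>) / (1 + (\<epsilon>u u)\<^sup>2 * \<epsilon>))"
      by (simp add: r_def \<tau>_def k_def)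
    show "ereal (2 / ln 3 * s) = ereal (2 / ln 3) *
       (SUP z\<in>space (prob_algebra M). SUP y. SUP u.
          hilbert_metric (posterior T Q z y u 1) (posterior T Q zs y u 1))"
      using s(1) by (simp add: S_def H_def \<pi>_def)
    show "\<forall>N\<ge>1. L_TV M T Q zs N \<le> ereal (r ^ (N - 1) * (2 / ln 3 * s))" using bound by blast
  qed
qed

end
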